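(* Consider the $H$-stage robust linear program $$\mathrm{RO}_H := \min_{x^1} c^{1\top}x^1+\sup_{\xi^1\in\Xi^1}\Big[\min_{x^2(\xi^1)}c^{2\top}(\xi^1)x^2(\xi^1)+\sup_{\xi^2\in\Xi^2}\Big[\cdots+\sup_{\xi^{H-1}\in\Xi^{H-1}}\Big[\min_{x^H(\boldsymbol\xi^{H-1})}c^{H\top}(\boldsymbol\xi^{H-1})x^H(\boldsymbol\xi^{H-1})\Big]\Big]\Big]$$ subject to $Ax^1=h^1$, $x^1\ge0$, and, for $t=2,\dots,H$ and all $\boldsymbol\xi^{t-1}\in\Xi^1\times\cdots\times\Xi^{t-1}$, $T^{t-1}(\boldsymbol\xi^{t-1})x^{t-1}(\boldsymbol\xi^{t-2})+W^t(\boldsymbol\xi^{t-1})x^t(\boldsymbol\xi^{t-1})=h^t(\boldsymbol\xi^{t-1})$ and $x^t(\boldsymbol\xi^{t-1})\ge0$. Consider also the robust multistage wait-and-see problem $$\mathrm{RWS}_H:=\sup_{\boldsymbol\xi^{H-1}\in\Xi}\ \min_{x^1(\boldsymbol\xi^{H-1}),\dots,x^H(\boldsymbol\xi^{H-1})}\ c^{1\top}x^1(\boldsymbol\xi^{H-1})+c^{2\top}(\xi^1)x^2(\boldsymbol\xi^{H-1})+\cdots+c^{H\top}(\boldsymbol\xi^{H-1})x^H(\boldsymbol\xi^{H-1}),$$ where, for each $\boldsymbol\xi^{H-1}\in\Xi$, the inner minimization is subject to $Ax^1(\boldsymbol\xi^{H-1})=h^1$, $x^1(\boldsymbol\xi^{H-1})\ge0$,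 and $T^{t-1}(\boldsymbol\xi^{t-1})x^{t-1}(\boldsymbol\xi^{H-1})+W^t(\boldsymbol\xi^{t-1})x^t(\boldsymbol\xi^{H-1})=h^t(\boldsymbol\xi^{t-1})$, $x^t(\boldsymbol\xi^{H-1})\ge0$ for $t=2,\dots,H$. Then $$\mathrm{RWS}_H\le\mathrm{RO}_H.$$
   Context: The uncertainty is a discrete-time random process $\xi^t$, $t=1,\dots,H-1$, with $\xi^t$ having support $\Xi^t\subseteq\mathbb{R}^{n_t}$; $\boldsymbol\xi^t:=(\xi^1,\dots,\xi^t)$ is the history up to time $t$, and $\Xi:=\Xi^1\times\cdots\times\Xi^{H-1}$. For $t=2$, $x^{t-1}(\boldsymbol\xi^{t-2})$ means $x^1$ and $\boldsymbol\xi^{t-1}=\xi^1$. The vectors $c^1\in\mathbb{R}^{n_1}$, $h^1\in\mathbb{R}^{m_1}$ and the matrix $A\in\mathbb{R}^{m_1\times n_1}$ are known; for $t=2,\dots,H$ the data $c^t(\boldsymbol\xi^{t-1})\in\mathbb{R}^{n_t}$, $h^t(\boldsymbol\xi^{t-1})\in\mathbb{R}^{m_t}$, $T^{t-1}(\boldsymbol\xi^{t-1})\in\mathbb{R}^{m_t\times n_{t-1}}$, $W^t(\boldsymbol\xi^{t-1})\in\mathbb{R}^{m_t\times n_t}$ depend on the history. In $\mathrm{RO}_H$ decisions are nonanticipative: $x^1$ is chosen before any uncertainty is revealed, and $x^t(\boldsymbol\xi^{t-1})\in\mathbb{R}^{n_t}$ depends only on the history $\boldsymbol\xi^{t-1}$.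 In $\mathrm{RWS}_H$ all decisions may depend on the entire realization $\boldsymbol\xi^{H-1}$. $\mathrm{RO}_H$ and $\mathrm{RWS}_H$ also denote the optimal values of the respective problems. Vector inequalities are componentwise. *)

theory Defs
  imports
    "HOL-Library.Extended_Real"
    "HOL-Library.FuncSet"
    Jordan_Normal_Form.Matrix
begin

text \<open>
  Stages are numbered \<open>1, \<dots>, H\<close>. The decision of stage \<open>t\<close> is a real vector of dimension \<open>n t\<close>.
  The history \<open>(\<xi>\<^sup>1, \<dots>, \<xi>\<^sup>t)\<close> is an element of \<open>\<Pi>\<^sub>E s\<in>{1..t}. \<Xi> s\<close>; the empty history is therefore
  \<open>\<lambda>_. undefined\<close>, and \<open>restrict \<xi> {1..t}\<close> is the history up to time \<open>t\<close> of a realization \<open>\<xi>\<close>.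

  Optimal values are extended reals, and \<open>min\<close> denotes the optimal value of a minimization problem:
  it is an infimum, equal to \<open>\<infinity>\<close> for an infeasible problem and to \<open>-\<infinity>\<close> for one that is unbounded
  below. No minimum is assumed to be attained. Since the objective terms are real, every sum below
  is of the form \<open>ereal r + v\<close>, so \<open>\<infinity> - \<infinity>\<close> does not arise.
\<close>

type_synonym history = "nat \<Rightarrow> real vec"

definition first_feasible :: "(nat \<Rightarrow> nat) \<Rightarrow> real mat \<Rightarrow> real vec \<Rightarrow> real vec set" where
  "first_feasible n A h1 =
    {x \<in> carrier_vec (n 1). A *\<^sub>v x = h1 \<and> 0\<^sub>v (n 1) \<le> x}"

context
  fixes n :: "nat \<Rightarrow> nat"
    and \<Xi> :: "nat \<Rightarrow> real vec set"
    and c h :: "nat \<Rightarrow> history \<Rightarrow> real vec"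
    and T W :: "nat \<Rightarrow> history \<Rightarrow> real mat"
begin

text \<open>Here \<open>\<xi>\<close> is the history up to time \<open>t - 1\<close> and \<open>x\<close> the decision of stage \<open>t - 1\<close>.\<close>

definition stage_feasible :: "nat \<Rightarrow> history \<Rightarrow> real vec \<Rightarrow> real vec set" where
  "stage_feasible t \<xi> x =
    {y \<in> carrier_vec (n t). T (t - 1) \<xi> *\<^sub>v x + W t \<xi> *\<^sub>v y = h t \<xi> \<and> 0\<^sub>v (n t) \<le> y}"

text \<open>
  \<open>nested_value k t \<xi> x\<close> is the part
  \<open>sup\<^bsub>\<xi>\<^sup>t\<^esub> [min\<^bsub>x\<^sup>t\<^sup>+\<^sup>1\<^esub> c\<^sup>t\<^sup>+\<^sup>1 x\<^sup>t\<^sup>+\<^sup>1 + sup\<^bsub>\<xi>\<^sup>t\<^sup>+\<^sup>1\<^esub> [\<dots>]]\<close> of the nested objective, in which \<open>k\<close> stages remain,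
  given the history \<open>\<xi>\<close> up to time \<open>t - 1\<close> and the decision \<open>x\<close> of stage \<open>t\<close>. Each vector \<open>y\<close> is
  chosen after the history \<open>\<xi>(t := u)\<close> and before any later uncertainty, so it is the value of
  the nonanticipative decision \<open>x\<^sup>t\<^sup>+\<^sup>1\<close> at that history.
\<close>

primrec nested_value :: "nat \<Rightarrow> nat \<Rightarrow> history \<Rightarrow> real vec \<Rightarrow> ereal" where
  "nested_value 0 t \<xi> x = 0"
| "nested_value (Suc k) t \<xi> x =
    (SUP u\<in>\<Xi> t. INF y\<in>stage_feasible (t + 1) (\<xi>(t := u)) x.
      ereal (c (t + 1) (\<xi>(t := u)) \<bullet> y) + nested_value k (t + 1) (\<xi>(t := u)) y)"

definition RO :: "nat \<Rightarrow> real vec \<Rightarrow> real vec \<Rightarrow> real mat \<Rightarrow> ereal" where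
  "RO H c1 h1 A =
    (INF x\<in>first_feasible n A h1. ereal (c1 \<bullet> x) + nested_value (H - 1) 1 (\<lambda>_. undefined) x)"

definition ws_feasible ::
  "nat \<Rightarrow> real vec \<Rightarrow> real mat \<Rightarrow> history \<Rightarrow> (nat \<Rightarrow> real vec) set" where
  "ws_feasible H h1 A \<xi> =
    {x \<in> \<Pi>\<^sub>E t\<in>{1..H}. carrier_vec (n t). x 1 \<in> first_feasible n A h1 \<and>
      (\<forall>t\<in>{2..H}. x t \<in> stage_feasible t (restrict \<xi> {1..t - 1}) (x (t - 1)))}"

definition RWS :: "nat \<Rightarrow> real vec \<Rightarrow> real vec \<Rightarrow> real mat \<Rightarrow> ereal" where
  "RWS H c1 h1 A =
    (SUP \<xi>\<in>(\<Pi>\<^sub>E t\<in>{1..H - 1}. \<Xi> t). INF x\<in>ws_feasible H h1 A \<xi>.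
      ereal (c1 \<bullet> x 1 + (\<Sum>t=2..H. c t (restrict \<xi> {1..t - 1}) \<bullet> x t)))"

end

end

theory Submission
  imports Defs
begin

text \<open>
  Fix a realization. A nonanticipative policy, followed along that realization, is one of the
  wait-and-see candidates. In terms of the nested values: the wait-and-see value is at most the cost
  of any feasible partial decision up to stage \<open>t\<close> plus the nested value from \<open>t\<close> on, by induction on
  the number of remaining stages; each supremum is bounded below by its term at the realization.
\<close>

text \<open>Since \<open>r\<close> is real, subtracting it on both sides is an equivalence in
  \<open>ereal\<close>, even at infinite values. Hence \<open>Y\<close> may be empty, as it is when
  a stage is infeasible.\<close>

lemma ereal_le_add_INF:
  fixes v :: ereal
  assumes "\<And>y. y \<in> Y \<Longrightarrow> v \<le> ereal r + f y"
  shows "v \<le> ereal r + (INF y\<in>Y. f y)"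
proof -
  have "v - ereal r \<le> (INF y\<in>Y. f y)"
    by (rule INF_greatest) (use assms in \<open>simp add: ereal_minus_le add.commute\<close>)
  then show ?thesis
    by (simp add: ereal_minus_le add.commute)
qed

text \<open>Links the two encodings of a history: \<open>nested_value\<close> grows it by updates,
  the wait-and-see problem cuts it out of a full realization.\<close>

lemma restrict_fun_upd_atLeastAtMost:
  fixes t :: nat
  assumes "1 \<le> t"
  shows "(restrict \<xi> {1..t - 1})(t := \<xi> t) = restrict \<xi> {1..t}"
  using assms by (auto simp: restrict_def fun_eq_iff)

text \<open>Using \<open>t\<close> as the horizon in \<open>ws_feasible\<close> expresses
  feasibility of the first \<open>t\<close> stages alone. At \<open>t = H\<close> the partial
  decision is itself a candidate for the infimum; at \<open>t = 1\<close> it is just a first-stage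
  decision.\<close>

lemma ws_value_le_prefix_cost_plus_nested_value:
  fixes c :: "nat \<Rightarrow> history \<Rightarrow> real vec"
  defines "cost \<equiv> \<lambda>c1 \<xi> t x. c1 \<bullet> x 1 + (\<Sum>s=2..t. c s (restrict \<xi> {1..s - 1}) \<bullet> x s)"
  assumes "t + k = H" and "1 \<le> t"
    and \<xi>: "\<xi> \<in> (\<Pi>\<^sub>E s\<in>{1..H - 1}. \<Xi> s)"
    and "x \<in> ws_feasible n h T W t h1 A \<xi>"
  shows "(INF z\<in>ws_feasible n h T W H h1 A \<xi>. ereal (cost c1 \<xi> H z))
    \<le> ereal (cost c1 \<xi> t x) + nested_value n \<Xi> c h T W k t (restrict \<xi> {1..t - 1}) (x t)"
  using assms(2,3,5)
proof (induction k arbitrary: t x)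
  case 0
  then show ?case
    by (auto intro: INF_lower)
next
  case (Suc k)
  let ?v = "INF z\<in>ws_feasible n h T W H h1 A \<xi>. ereal (cost c1 \<xi> H z)"
  let ?Y = "stage_feasible n h T W (t + 1) (restrict \<xi> {1..t}) (x t)"
  let ?f = "\<lambda>y. ereal (c (t + 1) (restrict \<xi> {1..t}) \<bullet> y)
    + nested_value n \<Xi> c h T W k (t + 1) (restrict \<xi> {1..t}) y"
  have "?v \<le> ereal (cost c1 \<xi> t x) + ?f y" if y: "y \<in> ?Y" for y
  proof -
    \<comment> \<open>The stage decision \<open>y\<close> prolongs the partial decision, so the
      induction hypothesis applies with one stage fewer remaining.\<close>
    let ?x = "x(t + 1 := y)"
    have "?x \<in> ws_feasible n h T W (t + 1) h1 A \<xi>"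
      unfolding ws_feasible_def
    proof (intro CollectI conjI ballI)
      have "{1..t + 1} = insert (t + 1) {1..t}"
        by auto
      then show "?x \<in> (\<Pi>\<^sub>E s\<in>{1..t + 1}. carrier_vec (n s))"
        using Suc.prems(3) y
        by (auto simp: ws_feasible_def stage_feasible_def simp del: fun_upd_apply
            intro!: PiE_fun_upd)
      show "?x 1 \<in> first_feasible n A h1"
        using Suc.prems(2,3) by (simp add: ws_feasible_def)
      show "?x s \<in> stage_feasible n h T W s (restrict \<xi> {1..s - 1}) (?x (s - 1))"
        if "s \<in> {2..t + 1}" for s
        using that Suc.prems(3) y by (cases "s = t + 1") (auto simp: ws_feasible_def)
    qed
    then have "?v \<le> ereal (cost c1 \<xi> (t + 1) ?x)
        + nested_value n \<Xi> c h T W k (t + 1) (restrict \<xi> {1..t + 1 - 1}) (?x (t + 1))"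
      using Suc.prems(1) by (intro Suc.IH) (simp_all del: fun_upd_apply)
    then have "?v \<le> ereal (cost c1 \<xi> (t + 1) ?x)
        + nested_value n \<Xi> c h T W k (t + 1) (restrict \<xi> {1..t}) y"
      by (simp only: fun_upd_same add_diff_cancel_right')
    \<comment> \<open>As \<open>1 \<le> t\<close>, the update leaves stage 1 alone and the sum gains
      exactly its last term.\<close>
    moreover have "cost c1 \<xi> (t + 1) ?x = cost c1 \<xi> t x + c (t + 1) (restrict \<xi> {1..t}) \<bullet> y"
      using Suc.prems(2) by (simp add: cost_def)
    ultimately show ?thesis
      by (simp add: add.assoc flip: plus_ereal.simps(1))
  qed
  then have "?v \<le> ereal (cost c1 \<xi> t x) + (INF y\<in>?Y. ?f y)"
    by (rule ereal_le_add_INF)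
  also have "(INF y\<in>?Y. ?f y)
      \<le> nested_value n \<Xi> c h T W (Suc k) t (restrict \<xi> {1..t - 1}) (x t)"
  proof -
    \<comment> \<open>At least one stage remains, so \<open>t \<le> H - 1\<close> and
      \<open>\<xi> t\<close> is an admissible choice in the supremum.\<close>
    have "\<xi> t \<in> \<Xi> t"
      using \<xi> Suc.prems by auto
    then show ?thesis
      unfolding nested_value.simps
      by (rule SUP_upper2) (simp add: restrict_fun_upd_atLeastAtMost[OF Suc.prems(2), simplified])
  qed
  finally show ?case
    by (simp only: add_left_mono)
qed

theorem proposition1:
  fixes H :: nat
    and n m :: "nat \<Rightarrow> nat"
    and \<Xi> :: "nat \<Rightarrow> real vec set"
    and c1 h1 :: "real vec"
    and A :: "real mat"
    and c h :: "nat \<Rightarrow> history \<Rightarrow> real vec"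
    and T W :: "nat \<Rightarrow> history \<Rightarrow> real mat"
  assumes "1 \<le> H"
    and "\<And>t. t \<in> {1..H - 1} \<Longrightarrow> \<Xi> t \<subseteq> carrier_vec (n t)"
    and "\<And>t. t \<in> {1..H - 1} \<Longrightarrow> \<Xi> t \<noteq> {}"
    and "c1 \<in> carrier_vec (n 1)"
    and "h1 \<in> carrier_vec (m 1)"
    and "A \<in> carrier_mat (m 1) (n 1)"
    and "\<And>t \<xi>. \<lbrakk>t \<in> {2..H}; \<xi> \<in> (\<Pi>\<^sub>E s\<in>{1..t - 1}. \<Xi> s)\<rbrakk> \<Longrightarrow> c t \<xi> \<in> carrier_vec (n t)"
    and "\<And>t \<xi>. \<lbrakk>t \<in> {2..H}; \<xi> \<in> (\<Pi>\<^sub>E s\<in>{1..t - 1}. \<Xi> s)\<rbrakk> \<Longrightarrow> h t \<xi> \<in> carrier_vec (m t)"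
    and "\<And>t \<xi>. \<lbrakk>t \<in> {2..H}; \<xi> \<in> (\<Pi>\<^sub>E s\<in>{1..t - 1}. \<Xi> s)\<rbrakk> \<Longrightarrow>
           T (t - 1) \<xi> \<in> carrier_mat (m t) (n (t - 1))"
    and "\<And>t \<xi>. \<lbrakk>t \<in> {2..H}; \<xi> \<in> (\<Pi>\<^sub>E s\<in>{1..t - 1}. \<Xi> s)\<rbrakk> \<Longrightarrow>
           W t \<xi> \<in> carrier_mat (m t) (n t)"
  shows "RWS n \<Xi> c h T W H c1 h1 A \<le> RO n \<Xi> c h T W H c1 h1 A"
  unfolding RWS_def RO_def
proof (intro SUP_least INF_greatest)
  fix \<xi> x
  assume \<xi>: "\<xi> \<in> (\<Pi>\<^sub>E t\<in>{1..H - 1}. \<Xi> t)" and x: "x \<in> first_feasible n A h1"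
  \<comment> \<open>Restricted to stage 1 because \<open>ws_feasible\<close> demands extensional
    functions; the constraints over \<open>{2..1}\<close> are vacuous.\<close>
  let ?z = "\<lambda>t\<in>{1..1::nat}. x"
  have "?z \<in> ws_feasible n h T W 1 h1 A \<xi>"
    using x by (auto simp: ws_feasible_def first_feasible_def)
  from ws_value_le_prefix_cost_plus_nested_value[OF _ _ \<xi> this, where k = "H - 1" and c = c and ?c1.0 = c1] assms(1)
  show "(INF z\<in>ws_feasible n h T W H h1 A \<xi>.
      ereal (c1 \<bullet> z 1 + (\<Sum>t=2..H. c t (restrict \<xi> {1..t - 1}) \<bullet> z t)))
    \<le> ereal (c1 \<bullet> x) + nested_value n \<Xi> c h T W (H - 1) 1 (\<lambda>_. undefined) x"
    \<comment> \<open>For \<open>t = 1\<close> the cost sum is empty and the restriction to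
      \<open>{1..0}\<close> is the empty history.\<close>
    by (simp add: restrict_def)
qed

end
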